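(* Let $d\ge1$ and $0<\alpha<1$. Let $u_0\in L^\infty(\mathbb R^d)$ be compactly supported, nonnegative, not identically zero and radially non-increasing, let $M=\|u_0\|_{L^1(\mathbb R^d)}$, and let $u$ be the solution by characteristics with rarefaction fans with datum $u_0$ (defined in the context). Put $$w(t,y)=t^{\frac1\alpha}\,u\bigl(t,t^{\frac1{d\alpha}}y\bigr),\qquad F_M(r)=\left(\alpha+\left(\frac{\omega_d r^d}{\alpha M}\right)^{\frac\alpha{1-\alpha}}\right)^{-\frac1\alpha}.$$ Then $$\sup_{y\in\mathbb R^d}\left|\frac{w(t,y)-F_M(|y|)}{F_M(|y|)}\right|\longrightarrow0\qquad\text{as }t\to+\infty.$$
   Context: $\omega_d$ is the volume of the unit ball of $\mathbb R^d$; radial functions on $\mathbb R^d$ are identified with functions of the volume variable $\rho=\omega_d|x|^d\ge0$. For a nonnegative, bounded, non-increasing $u_0:[0,\infty)\to[0,\infty)$, $u_0\not\equiv0$, let $m_0(\rho)=\int_0^\rho u_0(s)\,ds$, let $u_0(\rho^\pm)$ be the one-sided limits (with $u_0(0^-):=u_0(0^+)$), and let $D=\{(\rho_0,\eta_0):\rho_0\ge0,\ \eta_0>0,\ \eta_0\in[u_0(\rho_0^+),u_0(\rho_0^-)]\}$. For $t>0$ the map $P_t:D\to[0,+\infty)$, $P_t(\rho_0,\eta_0)=\rho_0+\alpha m_0(\rho_0)\eta_0^{\alpha-1}t$, is a bijection. The solution by characteristics with rarefaction fans with datum $u_0$ is $u(t,x)=(\eta_0^{-\alpha}+\alpha t)^{-1/\alpha}$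 with $(\rho_0,\eta_0)=P_t^{-1}(\omega_d|x|^d)$, $t>0$. *)

theory Defs
  imports "HOL-Analysis.Analysis"
begin

text \<open>
  The volume variable \<open>\<rho> = \<omega>\<^sub>d |x|\<^sup>d\<close> of a point of a \<open>d\<close>-dimensional Euclidean space,
  with \<open>\<omega>\<^sub>d\<close> given by \<^const>\<open>unit_ball_vol\<close>.
\<close>

lemma unit_ball_vol_eq_measure:
  "unit_ball_vol (real DIM('a)) = measure lborel (ball (0::'a::euclidean_space) 1)"
  by (simp add: content_ball)

definition vol_var :: "'a::euclidean_space \<Rightarrow> real" where
  "vol_var x = unit_ball_vol (real DIM('a)) * norm x ^ DIM('a)"

text \<open>
  Elements of \<open>L\<^sup>\<infinity>\<close> are represented by functions, so all properties of the datum are understood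
  almost everywhere. In particular compact support means vanishing almost everywhere outside some
  compact set.
\<close>

definition ess_bounded :: "('a::euclidean_space \<Rightarrow> real) \<Rightarrow> bool" where
  "ess_bounded f \<longleftrightarrow> f \<in> borel_measurable lebesgue \<and> (\<exists>C. AE x in lebesgue. \<bar>f x\<bar> \<le> C)"

definition compactly_supported :: "('a::euclidean_space \<Rightarrow> real) \<Rightarrow> bool" where
  "compactly_supported f \<longleftrightarrow> (\<exists>K. compact K \<and> (AE x in lebesgue. x \<notin> K \<longrightarrow> f x = 0))"

text \<open>
  A function \<open>v\<close> on \<open>[0, \<infinity>)\<close> (its values at negative arguments are never used) is
  identified with the radial function \<open>f\<close> if \<open>f\<close> is \<open>v\<close> of the volume variable.
\<close>

definition nonincreasing_profile :: "('a::euclidean_space \<Rightarrow> real) \<Rightarrow> (real \<Rightarrow> real) \<Rightarrow> bool" where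
  "nonincreasing_profile f v \<longleftrightarrow> antimono_on {0..} v \<and> (AE x in lebesgue. f x = v (vol_var x))"

definition right_lim :: "(real \<Rightarrow> real) \<Rightarrow> real \<Rightarrow> real" where
  "right_lim v \<rho> = Lim (at_right \<rho>) v"

definition left_lim :: "(real \<Rightarrow> real) \<Rightarrow> real \<Rightarrow> real" where
  "left_lim v \<rho> = (if \<rho> = 0 then right_lim v 0 else Lim (at_left \<rho>) v)"

definition cumulated_mass :: "(real \<Rightarrow> real) \<Rightarrow> real \<Rightarrow> real" where
  "cumulated_mass v \<rho> = (LBINT s:{0..\<rho>}. v s)"

definition char_domain :: "(real \<Rightarrow> real) \<Rightarrow> (real \<times> real) set" where
  "char_domain v = {(\<rho>, \<eta>). \<rho> \<ge> 0 \<and> \<eta> > 0 \<and> \<eta> \<in> {right_lim v \<rho>..left_lim v \<rho>}}"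

definition char_map :: "real \<Rightarrow> (real \<Rightarrow> real) \<Rightarrow> real \<Rightarrow> real \<times> real \<Rightarrow> real" where
  "char_map \<alpha> v t = (\<lambda>(\<rho>, \<eta>). \<rho> + \<alpha> * cumulated_mass v \<rho> * \<eta> powr (\<alpha> - 1) * t)"

text \<open>
  For \<open>t > 0\<close> and a profile, not almost everywhere zero, as in \<^const>\<open>nonincreasing_profile\<close> that is nonnegative on
  \<open>[0, \<infinity>)\<close>, \<^const>\<open>char_map\<close> is a bijection from \<^const>\<open>char_domain\<close> onto \<open>[0, \<infinity>)\<close>,
  so that \<^const>\<open>inv_into\<close> is its inverse.
\<close>

definition char_solution ::
    "real \<Rightarrow> (real \<Rightarrow> real) \<Rightarrow> real \<Rightarrow> 'a::euclidean_space \<Rightarrow> real" where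
  "char_solution \<alpha> v t x =
     (let (\<rho>, \<eta>) = inv_into (char_domain v) (char_map \<alpha> v t) (vol_var x)
      in (\<eta> powr (- \<alpha>) + \<alpha> * t) powr (- 1 / \<alpha>))"

definition rescaled ::
    "real \<Rightarrow> (real \<Rightarrow> 'a::euclidean_space \<Rightarrow> real) \<Rightarrow> real \<Rightarrow> 'a \<Rightarrow> real" where
  "rescaled \<alpha> u t y =
     t powr (1 / \<alpha>) * u t (t powr (1 / (real DIM('a) * \<alpha>)) *\<^sub>R y)"

definition F_profile :: "nat \<Rightarrow> real \<Rightarrow> real \<Rightarrow> real \<Rightarrow> real" where
  "F_profile d \<alpha> M r =
     (\<alpha> + (unit_ball_vol (real d) * r ^ d / (\<alpha> * M)) powr (\<alpha> / (1 - \<alpha>))) powr (- 1 / \<alpha>)"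

end

theory Submission
  imports Defs
begin

text \<open>
  Put \<open>m(\<rho>) = \<integral>\<^sub>0\<^sup>\<rho> v\<close>. At time \<open>t\<close> let \<open>(\<rho>, \<eta>)\<close> be the foot of the characteristic through a point
  whose volume variable, after rescaling, is \<open>Y\<close>, and write \<open>\<gamma> = \<alpha> / (1 - \<alpha>)\<close>, \<open>B = \<eta>\<^sup>-\<^sup>\<alpha> / t\<close>,
  \<open>A = (Y / (\<alpha> M))\<^sup>\<gamma>\<close>. Then \<open>w / F\<^sub>M = ((\<alpha> + A) / (\<alpha> + B))\<^bsup>1/\<alpha>\<^esup>\<close>, and the equation of the characteristic
  becomes \<open>A = (\<epsilon> + (m(\<rho>) / M) B\<^bsup>1/\<gamma>\<^esup>)\<^sup>\<gamma>\<close> with \<open>\<epsilon> = O(t\<^bsup>-1/\<alpha>\<^esup>)\<close>, because \<open>\<rho>\<close> stays in the support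
  of the datum. Either \<open>\<eta>\<close> is small, and then almost all the mass lies to the left of \<open>\<rho>\<close>, so that
  \<open>A\<close> is close to \<open>B\<close>; or it is not, and then \<open>A\<close> and \<open>B\<close> are both small. In both cases the
  quotient is close to \<open>1\<close>, uniformly in \<open>Y\<close>.
\<close>

section \<open>The volume variable and the image of Lebesgue measure under it\<close>

lemma vol_var_nonneg: "0 \<le> vol_var x"
  by (simp add: vol_var_def)

lemma continuous_on_vol_var: "continuous_on S vol_var"
  unfolding vol_var_def[abs_def] by (intro continuous_intros)

lemma vol_var_measurable [measurable]: "vol_var \<in> borel_measurable borel"
  by (intro borel_measurable_continuous_onI continuous_on_vol_var)

lemma vol_var_surj:
  assumes "0 \<le> \<rho>"
  obtains x :: "'a::euclidean_space" where "vol_var x = \<rho>"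
proof -
  define \<omega> where "\<omega> = unit_ball_vol (real DIM('a))"
  have \<omega>: "0 < \<omega>" by (simp add: \<omega>_def)
  obtain x :: 'a where x: "norm x = root DIM('a) (\<rho> / \<omega>)"
    using vector_choose_size[of "root DIM('a) (\<rho> / \<omega>)"] assms \<omega> by auto
  have "vol_var x = \<rho>"
    unfolding vol_var_def x \<omega>_def[symmetric] using assms \<omega> by simp
  then show thesis ..
qed

lemma vol_var_le_iff: "vol_var x \<le> vol_var y \<longleftrightarrow> norm x \<le> norm y"
  for x y :: "'a::euclidean_space"
  by (simp add: vol_var_def)

lemma emeasure_vol_var_sublevel:
  assumes "0 \<le> \<rho>"
  shows "emeasure lborel {x :: 'a::euclidean_space. vol_var x \<le> \<rho>} = ennreal \<rho>"
proof -
  obtain y :: 'a where y: "vol_var y = \<rho>" using vol_var_surj[OF assms] .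
  have "{x :: 'a. vol_var x \<le> \<rho>} = cball 0 (norm y)"
    unfolding y[symmetric] vol_var_le_iff by (simp add: cball_def)
  then have "emeasure lborel {x :: 'a. vol_var x \<le> \<rho>} = ennreal (vol_var y)"
    by (simp only: emeasure_cball[OF norm_ge_zero] vol_var_def)
  then show ?thesis by (simp only: y)
qed

text \<open>Turns integrals of radial functions into integrals over the half-line. The sets
  \<open>{..a}\<close> generate the Borel sets, and on them the claim reduces to the volume of a
  ball.\<close>

lemma distr_vol_var:
  "distr lborel borel (vol_var :: 'a::euclidean_space \<Rightarrow> real) = density lborel (indicator {0..})"
proof (rule measure_eqI_generator_eq[where E = "range atMost" and \<Omega> = UNIV and A = "\<lambda>n. {..real n}"])
  show "Int_stable (range atMost :: real set set)"
    by (auto simp: Int_stable_def)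
  show "sets (distr lborel borel (vol_var :: 'a \<Rightarrow> real)) = sigma_sets UNIV (range atMost)"
    by (simp add: borel_eq_atMost)
  show "sets (density lborel (indicator {0::real..})) = sigma_sets UNIV (range atMost)"
    by (simp add: borel_eq_atMost)
  show "(\<Union>n. {..real n}) = UNIV" by (auto intro: real_arch_simple)
  have preimage: "emeasure (distr lborel borel (vol_var :: 'a \<Rightarrow> real)) {..a}
      = emeasure lborel {x :: 'a. vol_var x \<le> a}" for a
    by (subst emeasure_distr) (auto intro!: arg_cong[where f = "emeasure lborel"])
  have density: "emeasure (density lborel (indicator {0..})) {..a} = emeasure lborel {0..a}" for a :: real
  proof -
    have "emeasure (density lborel (indicator {0..})) {..a} = (\<integral>\<^sup>+ s. indicator {0..} s * indicator {..a} s \<partial>lborel)"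
      by (rule emeasure_density) auto
    also have "\<dots> = (\<integral>\<^sup>+ s. indicator {0..a} s \<partial>lborel)"
      by (rule nn_integral_cong) (simp add: indicator_def)
    also have "\<dots> = emeasure lborel {0..a}" by (rule nn_integral_indicator) simp
    finally show ?thesis .
  qed
  show "emeasure (distr lborel borel (vol_var :: 'a \<Rightarrow> real)) X = emeasure (density lborel (indicator {0..})) X"
    if X: "X \<in> range atMost" for X
  proof -
    obtain a where a: "X = {..a}" using X by auto
    show ?thesis
    proof (cases "0 \<le> a")
      case True
      then show ?thesis by (simp add: a preimage density emeasure_vol_var_sublevel)
    next
      case False
      then have "{x :: 'a. vol_var x \<le> a} = {}"
        using order_trans[OF vol_var_nonneg] by blast
      with False show ?thesis by (simp only: a preimage density) simp
    qed
  qed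
  show "emeasure (distr lborel borel (vol_var :: 'a \<Rightarrow> real)) {..real n} \<noteq> \<infinity>" for n
    by (simp add: preimage emeasure_vol_var_sublevel)
qed auto

text \<open>The preimage of an open interval of positive numbers is a nonempty open set, hence not a
  null set. This moves almost-everywhere information on a radial datum to actual points of its
  profile.\<close>

lemma AE_vol_var_interval:
  assumes "0 \<le> a" "a < b" and AE: "AE x in lebesgue. P (vol_var (x :: 'a::euclidean_space))"
  shows "\<exists>s\<in>{a<..<b}. P s"
proof (rule ccontr)
  assume none: "\<not> ?thesis"
  define U where "U = (vol_var -` {a<..<b} :: 'a set)"
  have "open U"
    unfolding U_def using continuous_on_vol_var by (intro open_vimage) auto
  have "0 \<le> (a + b) / 2" using assms by simp
  from vol_var_surj[OF this] obtain x :: 'a where "vol_var x = (a + b) / 2" .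
  then have "x \<in> U" using assms(2) by (simp add: U_def)
  then have "U \<noteq> {}" by blast
  have "AE x in lebesgue. x \<notin> U"
    using AE by (rule eventually_mono) (use none in \<open>auto simp: U_def\<close>)
  then have "U \<in> null_sets lebesgue"
    using \<open>open U\<close> by (subst AE_iff_null_sets) (auto intro: lmeasurable_open borel_open)
  then show False
    using open_not_negligible[OF \<open>open U\<close> \<open>U \<noteq> {}\<close>] by (simp add: negligible_iff_null_sets)
qed

section \<open>Elementary power estimates\<close>

text \<open>If \<open>x\<close> is at least \<open>sqrt e\<close>, the shift \<open>e\<close> is at
  most \<open>sqrt e * x\<close>, a small relative perturbation; otherwise the whole power is small
  compared with \<alpha>. With the threshold \<open>sqrt e\<close> both entries of the maximum tend
  to 1 as \<open>e\<close> tends to 0.\<close>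

lemma add_powr_le:
  fixes \<alpha> \<gamma> e x :: real
  assumes "0 < \<alpha>" "0 < \<gamma>" "0 \<le> e" "0 \<le> x"
  shows "\<alpha> + (e + x) powr \<gamma>
    \<le> max ((1 + sqrt e) powr \<gamma>) (1 + (e + sqrt e) powr \<gamma> / \<alpha>) * (\<alpha> + x powr \<gamma>)"
proof (cases "sqrt e \<le> x")
  case True
  have "e = sqrt e * sqrt e" using assms by simp
  also have "\<dots> \<le> sqrt e * x" using True assms by (intro mult_left_mono) auto
  finally have "(e + x) powr \<gamma> \<le> ((1 + sqrt e) * x) powr \<gamma>"
    using assms by (intro powr_mono2) (auto simp: algebra_simps)
  also have "\<dots> = (1 + sqrt e) powr \<gamma> * x powr \<gamma>"
    by (rule powr_mult)
  finally have "\<alpha> + (e + x) powr \<gamma> \<le> 1 * \<alpha> + (1 + sqrt e) powr \<gamma> * x powr \<gamma>" by simp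
  also have "\<dots> \<le> (1 + sqrt e) powr \<gamma> * \<alpha> + (1 + sqrt e) powr \<gamma> * x powr \<gamma>"
    using assms by (intro add_mono mult_right_mono ge_one_powr_ge_zero) auto
  also have "\<dots> = (1 + sqrt e) powr \<gamma> * (\<alpha> + x powr \<gamma>)" by (simp add: algebra_simps)
  also have "\<dots> \<le> max ((1 + sqrt e) powr \<gamma>) (1 + (e + sqrt e) powr \<gamma> / \<alpha>) * (\<alpha> + x powr \<gamma>)"
    using assms by (intro mult_right_mono) auto
  finally show ?thesis .
next
  case False
  then have "(e + x) powr \<gamma> \<le> (e + sqrt e) powr \<gamma>"
    using assms by (intro powr_mono2) auto
  then have "\<alpha> + (e + x) powr \<gamma> \<le> (1 + (e + sqrt e) powr \<gamma> / \<alpha>) * \<alpha>"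
    using assms by (simp add: distrib_right)
  also have "\<dots> \<le> (1 + (e + sqrt e) powr \<gamma> / \<alpha>) * (\<alpha> + x powr \<gamma>)"
    using assms by (intro mult_left_mono) auto
  also have "\<dots> \<le> max ((1 + sqrt e) powr \<gamma>) (1 + (e + sqrt e) powr \<gamma> / \<alpha>) * (\<alpha> + x powr \<gamma>)"
    using assms by (intro mult_right_mono) auto
  finally show ?thesis .
qed

lemma powr_deviation:
  fixes q :: real
  assumes "0 \<le> l" "l \<le> q" "q \<le> u" "0 \<le> p"
  shows "\<bar>q powr p - 1\<bar> \<le> \<bar>u powr p - 1\<bar> + \<bar>l powr p - 1\<bar>"
  using powr_mono2[of p l q] powr_mono2[of p q u] assms by linarith

section \<open>Profiles and their cumulated mass\<close>

text \<open>Collects pointwise what the datum provides only almost everywhere. \<open>R\<close>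
  bounds the support in the volume variable, so \<open>cumulated_mass v R\<close> is the total mass.
  Positivity is asked at some \<open>s > 0\<close> because the value at 0 alone carries no
  mass.\<close>

locale volume_profile =
  fixes v :: "real \<Rightarrow> real" and R :: real
  assumes antimono: "antimono_on {0..} v"
    and nonneg: "0 \<le> s \<Longrightarrow> 0 \<le> v s"
    and R_nonneg: "0 \<le> R"
    and support: "R < s \<Longrightarrow> v s = 0"
    and nontrivial: "\<exists>s>0. 0 < v s"
begin

lemma antimonoD: "0 \<le> a \<Longrightarrow> a \<le> b \<Longrightarrow> v b \<le> v a"
  using antimono by (auto simp: monotone_on_def)

text \<open>Freezing the profile at \<open>v 0\<close> for negative arguments makes it monotone on
  the whole line, hence Borel.\<close>

lemma measurable_extension: "(\<lambda>s. v (max 0 s)) \<in> borel_measurable borel"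
proof -
  have "mono (\<lambda>s. - v (max 0 s))"
    by (auto simp: mono_def intro!: antimonoD)
  then have "(\<lambda>s. - (- v (max 0 s))) \<in> borel_measurable borel"
    by (intro borel_measurable_uminus borel_measurable_mono)
  then show ?thesis by simp
qed

lemma set_integrable_profile:
  assumes "0 \<le> a"
  shows "set_integrable lborel {a..b} v"
proof -
  have "set_integrable lborel {a..b} (\<lambda>s. v (max 0 s))"
  proof (rule set_integrable_bound[where f = "\<lambda>_. v 0"])
    show "set_integrable lborel {a..b} (\<lambda>_. v 0)"
      by (intro borel_integrable_atLeastAtMost' continuous_on_const)
    show "set_borel_measurable lborel {a..b} (\<lambda>s. v (max 0 s))"
      using measurable_extension unfolding set_borel_measurable_def by measurable
    show "AE s in lborel. s \<in> {a..b} \<longrightarrow> norm (v (max 0 s)) \<le> norm (v 0)"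
    proof (intro AE_I2 impI)
      fix s :: real
      have "0 \<le> v (max 0 s)" "v (max 0 s) \<le> v 0"
        by (simp_all add: nonneg antimonoD)
      then show "norm (v (max 0 s)) \<le> norm (v 0)" by simp
    qed
  qed
  also have "set_integrable lborel {a..b} (\<lambda>s. v (max 0 s)) = set_integrable lborel {a..b} v"
    using assms by (intro set_integrable_cong) auto
  finally show ?thesis .
qed

abbreviation m :: "real \<Rightarrow> real" where "m \<equiv> cumulated_mass v"

text \<open>The source of all growth estimates for \<open>m\<close>: \<open>c = 0\<close> gives
  monotonicity, \<open>C = v 0\<close> the Lipschitz bound, \<open>C = 0\<close> constancy beyond
  \<open>R\<close>. The bounds are asked only for \<open>s > a\<close>, since at the foot of a
  characteristic only points strictly to its right are controlled.\<close>

lemma mass_diff_bounds: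
  assumes "0 \<le> a" "a \<le> b" and bounds: "\<And>s. a < s \<Longrightarrow> s \<le> b \<Longrightarrow> c \<le> v s \<and> v s \<le> C"
  shows "c * (b - a) \<le> m b - m a" and "m b - m a \<le> C * (b - a)"
proof -
  have int: "set_integrable lborel {a<..b} v"
    using set_integrable_profile[OF \<open>0 \<le> a\<close>, of b] by (rule set_integrable_subset) auto
  have "{0..b} = {0..a} \<union> {a<..b}" using assms by auto
  moreover have "{0..a} \<inter> {a<..b} = {}" by auto
  ultimately have diff: "m b - m a = (LBINT s:{a<..b}. v s)"
    unfolding cumulated_mass_def
    using set_integral_Un[OF _ set_integrable_profile[of 0 a] int] by simp
  have const: "set_integrable lborel {a<..b} (\<lambda>_. k)" "(LBINT s:{a<..b}. k) = k * (b - a)"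
    for k :: real
  proof -
    show "set_integrable lborel {a<..b} (\<lambda>_. k)"
      by (rule set_integrable_subset[OF borel_integrable_atLeastAtMost'[of a b]]) auto
    show "(LBINT s:{a<..b}. k) = k * (b - a)"
      using assms(2) by (subst set_integral_const) auto
  qed
  have "(LBINT s:{a<..b}. c) \<le> (LBINT s:{a<..b}. v s)" "(LBINT s:{a<..b}. v s) \<le> (LBINT s:{a<..b}. C)"
    using bounds by (intro set_integral_mono const int; simp)+
  then show "c * (b - a) \<le> m b - m a" "m b - m a \<le> C * (b - a)"
    unfolding diff const .
qed

lemma mass_0: "m 0 = 0"
proof -
  have "AE s in lborel. indicator {0..0} s *\<^sub>R v s = 0"
    using AE_lborel_singleton[of 0] by eventually_elim (simp add: indicator_def)
  then show ?thesis
    unfolding cumulated_mass_def set_lebesgue_integral_def by (rule integral_eq_zero_AE)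
qed

lemma mass_mono:
  assumes "0 \<le> a" "a \<le> b"
  shows "m a \<le> m b"
  using mass_diff_bounds(1)[OF assms, of 0 "v 0"] assms nonneg antimonoD by force

lemma mass_nonneg: "0 \<le> a \<Longrightarrow> 0 \<le> m a"
  using mass_mono[of 0 a] mass_0 by simp

lemma mass_lipschitz:
  assumes "0 \<le> a" "a \<le> b"
  shows "m b - m a \<le> v 0 * (b - a)"
  using mass_diff_bounds(2)[OF assms, of 0 "v 0"] assms nonneg antimonoD by force

lemma continuous_on_mass: "continuous_on {0..} m"
proof (rule lipschitz_on_continuous_on)
  show "(v 0)-lipschitz_on {0..} m"
  proof (rule lipschitz_onI)
    fix a b :: real
    assume "a \<in> {0..}" "b \<in> {0..}"
    then show "dist (m a) (m b) \<le> v 0 * dist a b"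
      using mass_lipschitz[of a b] mass_lipschitz[of b a] mass_mono[of a b] mass_mono[of b a]
      by (cases "a \<le> b") (auto simp: dist_real_def abs_if)
  qed (simp add: nonneg)
qed

text \<open>To the left of a point \<open>s1\<close> with \<open>v s1 > 0\<close> the profile is at
  least \<open>v s1\<close>, so the mass grows at least linearly from 0.\<close>

lemma mass_pos:
  assumes "0 < s"
  shows "0 < m s"
proof -
  obtain s1 where s1: "0 < s1" "0 < v s1" using nontrivial by blast
  define r where "r = min s s1"
  have r: "0 < r" "r \<le> s" "r \<le> s1" using assms s1 by (auto simp: r_def)
  have "v s1 * (r - 0) \<le> m r - m 0"
    using r by (intro mass_diff_bounds(1)[where C = "v 0"]) (auto intro!: antimonoD)
  then have "v s1 * r \<le> m r" using mass_0 by simp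
  moreover have "0 < v s1 * r" using r s1 by simp
  ultimately show ?thesis using mass_mono[of r s] r by linarith
qed

lemma mass_le_total:
  assumes "0 \<le> a"
  shows "m a \<le> m R"
proof (cases "a \<le> R")
  case True
  with assms show ?thesis by (rule mass_mono)
next
  case False
  then have "m a - m R \<le> 0 * (a - R)"
    using R_nonneg by (intro mass_diff_bounds(2)[where c = 0]) (auto simp: support)
  then show ?thesis by simp
qed

lemma total_mass_pos: "0 < m R"
  using mass_pos[of 1] mass_le_total[of 1] by simp

section \<open>One-sided limits and the domain of the characteristics\<close>

text \<open>\<open>right_lim\<close> is defined through \<open>Lim\<close>, so existence of the
  limit must be shown: by monotonicity it is the supremum of the values to the right of
  \<rho>.\<close>

lemma tendsto_right_lim: "0 \<le> \<rho> \<Longrightarrow> (v \<longlongrightarrow> right_lim v \<rho>) (at_right \<rho>)"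
proof -
  assume \<rho>: "0 \<le> \<rho>"
  have bdd: "bdd_above (v ` {\<rho><..})"
    using \<rho> by (intro bdd_aboveI2[of _ _ "v 0"]) (auto intro!: antimonoD)
  have "(v \<longlongrightarrow> (SUP s\<in>{\<rho><..}. v s)) (at_right \<rho>)"
  proof (rule increasing_tendsto)
    show "\<forall>\<^sub>F s in at_right \<rho>. v s \<le> (SUP s\<in>{\<rho><..}. v s)"
      using eventually_at_right_less by (rule eventually_mono) (use bdd in \<open>auto intro!: cSUP_upper\<close>)
    fix c assume "c < (SUP s\<in>{\<rho><..}. v s)"
    then obtain s where s: "\<rho> < s" "c < v s"
      using less_cSUP_iff[of "{\<rho><..}" v c] bdd by auto
    have "\<forall>\<^sub>F r in at_right \<rho>. r \<in> {\<rho><..<s}"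
      using s by (intro eventually_at_right_real)
    then show "\<forall>\<^sub>F r in at_right \<rho>. c < v r"
    proof (rule eventually_mono)
      fix r assume "r \<in> {\<rho><..<s}"
      then have "v s \<le> v r" using \<rho> by (intro antimonoD) auto
      with s(2) show "c < v r" by simp
    qed
  qed
  from this tendsto_Lim[OF trivial_limit_at_right_real this] show ?thesis
    by (simp add: right_lim_def)
qed

lemma tendsto_left_lim: "0 < \<rho> \<Longrightarrow> (v \<longlongrightarrow> left_lim v \<rho>) (at_left \<rho>)"
proof -
  assume \<rho>: "0 < \<rho>"
  have bdd: "bdd_below (v ` {0<..<\<rho>})"
    by (intro bdd_belowI2[of _ 0]) (auto intro!: nonneg)
  have near: "\<forall>\<^sub>F r in at_left \<rho>. r \<in> {s<..<\<rho>}" if "s < \<rho>" for s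
    using that by (intro eventually_at_left_real)
  have "(v \<longlongrightarrow> (INF s\<in>{0<..<\<rho>}. v s)) (at_left \<rho>)"
  proof (rule decreasing_tendsto)
    show "\<forall>\<^sub>F s in at_left \<rho>. (INF s\<in>{0<..<\<rho>}. v s) \<le> v s"
      using near[OF \<rho>] by (rule eventually_mono) (use bdd in \<open>auto intro!: cINF_lower\<close>)
    fix c assume "(INF s\<in>{0<..<\<rho>}. v s) < c"
    then obtain s where s: "0 < s" "s < \<rho>" "v s < c"
      using cINF_less_iff[of "{0<..<\<rho>}" v c] bdd \<rho> by auto
    show "\<forall>\<^sub>F r in at_left \<rho>. v r < c"
      using near[OF s(2)]
    proof (rule eventually_mono)
      fix r assume "r \<in> {s<..<\<rho>}"
      then have "v r \<le> v s" using s(1) by (intro antimonoD) auto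
      with s(3) show "v r < c" by simp
    qed
  qed
  from this tendsto_Lim[OF trivial_limit_at_left_real this] show ?thesis
    using \<rho> by (simp add: left_lim_def)
qed

lemma le_right_lim:
  assumes "0 \<le> \<rho>" "\<rho> < s"
  shows "v s \<le> right_lim v \<rho>"
proof (rule tendsto_lowerbound[OF tendsto_right_lim[OF assms(1)]])
  have "\<forall>\<^sub>F r in at_right \<rho>. r \<in> {\<rho><..<s}"
    using assms by (intro eventually_at_right_real)
  then show "\<forall>\<^sub>F r in at_right \<rho>. v s \<le> v r"
    by (rule eventually_mono) (use assms antimonoD in auto)
qed simp

lemma left_lim_beyond_support:
  assumes "R < \<rho>"
  shows "left_lim v \<rho> = 0"
proof -
  have "\<forall>\<^sub>F r in at_left \<rho>. r \<in> {R<..<\<rho>}"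
    using assms by (intro eventually_at_left_real)
  then have "\<forall>\<^sub>F r in at_left \<rho>. v r = 0"
    by (rule eventually_mono) (auto simp: support)
  then have lim0: "(v \<longlongrightarrow> 0) (at_left \<rho>)" by (rule tendsto_eventually)
  have "0 < \<rho>" using R_nonneg assms by simp
  from tendsto_unique[OF trivial_limit_at_left_real tendsto_left_lim[OF this] lim0] show ?thesis .
qed

text \<open>Positivity of \<eta> keeps the foot of a characteristic inside the support; this makes
  its own displacement negligible after rescaling. The last claim bounds the mass to the right of
  the foot.\<close>

lemma char_domainD:
  assumes D: "(\<rho>, \<eta>) \<in> char_domain v"
  shows "0 < \<eta>" "0 \<le> \<rho>" "\<rho> \<le> R" and "\<And>s. \<rho> < s \<Longrightarrow> v s \<le> \<eta>"
proof -
  show "0 < \<eta>" and \<rho>: "0 \<le> \<rho>" using D by (auto simp: char_domain_def)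
  have \<eta>: "right_lim v \<rho> \<le> \<eta>" "\<eta> \<le> left_lim v \<rho>"
    using D by (auto simp: char_domain_def)
  show "\<rho> \<le> R"
    using \<eta>(2) \<open>0 < \<eta>\<close> left_lim_beyond_support[of \<rho>] by (cases "\<rho> \<le> R") auto
  show "v s \<le> \<eta>" if "\<rho> < s" for s
    using le_right_lim[OF \<rho> that] \<eta>(1) by simp
qed

section \<open>Continuity of the mass and surjectivity of the characteristic map\<close>

lemma tendsto_right_mass:
  assumes "0 \<le> s"
  shows "(m \<longlongrightarrow> m s) (at_right s)"
proof -
  have "(m \<longlongrightarrow> m s) (at s within {0..})"
    using continuous_on_mass assms by (auto simp: continuous_on_def)
  then show ?thesis by (rule tendsto_within_subset) (use assms in auto)
qed

lemma tendsto_left_mass: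
  assumes "0 < s"
  shows "(m \<longlongrightarrow> m s) (at_left s)"
proof -
  have "continuous_on {0<..} m"
    using continuous_on_mass by (rule continuous_on_subset) auto
  then have "isCont m s"
    using assms by (simp add: continuous_on_eq_continuous_at)
  then show ?thesis by (simp add: isCont_def filterlim_at_split)
qed

text \<open>An intermediate value argument for a monotone function with jumps, where the vertical
  segments of \<open>char_domain\<close> (the fans) fill the jumps. Surjectivity makes
  \<open>inv_into\<close> return a genuine preimage.\<close>

lemma char_map_surj:
  assumes \<alpha>: "0 < \<alpha>" "\<alpha> < 1" and t: "0 < t" and \<rho>: "0 \<le> \<rho>"
  shows "\<rho> \<in> char_map \<alpha> v t ` char_domain v"
proof -
  have right_lim_0: "0 < right_lim v 0"
    using nontrivial le_right_lim[of 0] by force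
  show ?thesis
  proof (cases "\<rho> = 0")
    case True
    \<comment> \<open>The convention \<open>left_lim v 0 = right_lim v 0\<close> leaves exactly this
      value of \<eta> over 0, and the point does not move because \<open>m 0 = 0\<close>.\<close>
    have "(0, right_lim v 0) \<in> char_domain v"
      using right_lim_0 by (simp add: char_domain_def left_lim_def)
    moreover have "char_map \<alpha> v t (0, right_lim v 0) = \<rho>"
      using True by (simp add: char_map_def mass_0)
    ultimately show ?thesis by (metis image_eqI)
  next
    case False
    with \<rho> have \<rho>: "0 < \<rho>" by simp
    \<comment> \<open>For \<open>v s > 0\<close>, \<open>k s \<ge> 0\<close> says that the characteristic starting at \<open>(s, v s)\<close> has not
      passed \<open>\<rho>\<close> at time \<open>t\<close>.\<close>
    define k where "k = (\<lambda>s. v s powr (1 - \<alpha>) * (\<rho> - s) - \<alpha> * m s * t)"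
    have k_mono: "k b \<le> k a" if "0 \<le> a" "a \<le> b" "b \<le> \<rho>" for a b
    proof -
      have "v b powr (1 - \<alpha>) * (\<rho> - b) \<le> v a powr (1 - \<alpha>) * (\<rho> - a)"
        using that \<alpha> by (intro mult_mono powr_mono2 antimonoD nonneg) auto
      moreover have "\<alpha> * m a * t \<le> \<alpha> * m b * t"
        using that \<alpha> t by (intro mult_right_mono mult_left_mono mass_mono) auto
      ultimately show ?thesis by (simp add: k_def)
    qed
    have k_right: "(k \<longlongrightarrow> right_lim v s powr (1 - \<alpha>) * (\<rho> - s) - \<alpha> * m s * t) (at_right s)"
      if "0 \<le> s" for s
    proof -
      \<comment> \<open>The limit of \<open>v\<close> may be 0, so continuity of the power is taken
        for an eventually nonnegative base and a positive exponent.\<close>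
      have "\<forall>\<^sub>F r in at_right s. 0 \<le> v r"
        using eventually_at_right_less[of s] by (rule eventually_mono) (use that in \<open>auto intro: nonneg\<close>)
      then show ?thesis
        unfolding k_def using that \<alpha>
        by (intro tendsto_intros tendsto_powr2 tendsto_right_lim tendsto_right_mass) auto
    qed
    have k_left: "(k \<longlongrightarrow> left_lim v s powr (1 - \<alpha>) * (\<rho> - s) - \<alpha> * m s * t) (at_left s)"
      if "0 < s" for s
    proof -
      have "\<forall>\<^sub>F r in at_left s. 0 \<le> v r"
        using eventually_at_left_real[OF that] by (rule eventually_mono) (auto intro: nonneg)
      then show ?thesis
        unfolding k_def using that \<alpha>
        by (intro tendsto_intros tendsto_powr2 tendsto_left_lim tendsto_left_mass) auto
    qed
    \<comment> \<open>At \<open>s0\<close> the antitone function \<open>k\<close> changes sign. Its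
      two one-sided limits there give \<open>left\<close> and \<open>right\<close>, which place the
      wanted \<eta> between the one-sided limits of \<open>v\<close>.\<close>
    define S where "S = {s \<in> {0<..\<rho>}. 0 \<le> k s}"
    define s0 where "s0 = Sup S"
    have "S \<noteq> {}"
    proof -
      \<comment> \<open>Near 0 the mass term vanishes while \<open>v\<close> stays away from 0, so
        \<open>k\<close> is positive just to the right of 0.\<close>
      have "0 < right_lim v 0 powr (1 - \<alpha>) * (\<rho> - 0) - \<alpha> * m 0 * t"
        using right_lim_0 \<rho> by (simp add: mass_0)
      from order_tendstoD(1)[OF k_right[of 0] this]
      have "\<forall>\<^sub>F s in at_right 0. 0 < k s" by simp
      moreover have "\<forall>\<^sub>F s in at_right 0. s \<in> {0<..<\<rho>}"
        using \<rho> by (intro eventually_at_right_real)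
      ultimately have "\<forall>\<^sub>F s in at_right 0. s \<in> S"
        by eventually_elim (auto simp: S_def)
      then show ?thesis
        using eventually_happens by (metis empty_iff trivial_limit_at_right_real)
    qed
    have bdd: "bdd_above S" by (auto simp: S_def intro!: bdd_aboveI[of _ \<rho>])
    have s0_upper: "s \<le> s0" if "s \<in> S" for s
      unfolding s0_def using bdd that by (rule cSup_upper[rotated])
    have s0: "0 < s0" "s0 \<le> \<rho>"
    proof -
      show "0 < s0" using \<open>S \<noteq> {}\<close> s0_upper by (force simp: S_def)
      show "s0 \<le> \<rho>" unfolding s0_def using \<open>S \<noteq> {}\<close> by (rule cSup_least) (simp add: S_def)
    qed
    have left: "\<alpha> * m s0 * t \<le> left_lim v s0 powr (1 - \<alpha>) * (\<rho> - s0)"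
    proof -
      have "\<forall>\<^sub>F s in at_left s0. 0 \<le> k s"
        using eventually_at_left_real[OF s0(1)]
      proof (rule eventually_mono)
        fix s assume s: "s \<in> {0<..<s0}"
        then obtain r where "r \<in> S" "s < r"
          using less_cSupE[of s S] \<open>S \<noteq> {}\<close> by (auto simp: s0_def)
        then show "0 \<le> k s" using k_mono[of s r] s by (auto simp: S_def)
      qed
      then have "0 \<le> left_lim v s0 powr (1 - \<alpha>) * (\<rho> - s0) - \<alpha> * m s0 * t"
        by (intro tendsto_lowerbound[OF k_left[OF s0(1)]]) auto
      then show ?thesis by simp
    qed
    have pos: "0 < \<alpha> * m s0 * t" using \<alpha> t mass_pos[OF s0(1)] by simp
    with left have "0 < left_lim v s0 powr (1 - \<alpha>) * (\<rho> - s0)" by linarith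
    then have "s0 < \<rho>" using s0(2) by (cases "s0 = \<rho>") auto
    have right: "right_lim v s0 powr (1 - \<alpha>) * (\<rho> - s0) \<le> \<alpha> * m s0 * t"
    proof -
      have "\<forall>\<^sub>F s in at_right s0. k s \<le> 0"
        using eventually_at_right_real[OF \<open>s0 < \<rho>\<close>]
      proof (rule eventually_mono)
        fix s assume s: "s \<in> {s0<..<\<rho>}"
        then have "s \<notin> S" using s0_upper[of s] by auto
        then show "k s \<le> 0" using s s0 by (auto simp: S_def)
      qed
      then have "right_lim v s0 powr (1 - \<alpha>) * (\<rho> - s0) - \<alpha> * m s0 * t \<le> 0"
        using s0 by (intro tendsto_upperbound[OF k_right]) auto
      then show ?thesis by simp
    qed
    \<comment> \<open>\<open>q\<close> is the value of \<open>\<eta> powr (1 - \<alpha>)\<close> for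
      which the characteristic from \<open>s0\<close> reaches \<rho> at time
      \<open>t\<close>.\<close>
    define q where "q = \<alpha> * m s0 * t / (\<rho> - s0)"
    define \<eta> where "\<eta> = q powr (1 / (1 - \<alpha>))"
    have q: "0 < q" using pos \<open>s0 < \<rho>\<close> by (simp add: q_def)
    then have \<eta>: "0 < \<eta>" by (simp add: \<eta>_def)
    have bounds: "right_lim v s0 powr (1 - \<alpha>) \<le> q" "q \<le> left_lim v s0 powr (1 - \<alpha>)"
      using left right \<open>s0 < \<rho>\<close> by (auto simp: q_def field_simps)
    have lims_nonneg: "0 \<le> right_lim v s0" "0 \<le> left_lim v s0"
    proof -
      show "0 \<le> right_lim v s0"
        using le_right_lim[of s0 "s0 + 1"] nonneg[of "s0 + 1"] s0 by simp
      have "\<forall>\<^sub>F r in at_left s0. 0 \<le> v r"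
        using eventually_at_left_real[OF s0(1)] by (rule eventually_mono) (auto intro: nonneg)
      then show "0 \<le> left_lim v s0"
        using s0 by (intro tendsto_lowerbound[OF tendsto_left_lim]) auto
    qed
    have inverse_powr: "(x powr (1 - \<alpha>)) powr (1 / (1 - \<alpha>)) = x" if "0 \<le> x" for x :: real
      using that \<alpha> by (simp add: powr_powr)
    have "right_lim v s0 \<le> \<eta>"
      using powr_mono2[OF _ _ bounds(1), of "1 / (1 - \<alpha>)"] lims_nonneg \<alpha>
      by (simp add: \<eta>_def inverse_powr)
    moreover have "\<eta> \<le> left_lim v s0"
      using powr_mono2[OF _ _ bounds(2), of "1 / (1 - \<alpha>)"] lims_nonneg \<alpha> q
      by (simp add: \<eta>_def inverse_powr)
    ultimately have "(s0, \<eta>) \<in> char_domain v"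
      using s0 \<eta> by (simp add: char_domain_def)
    moreover have "\<eta> powr (\<alpha> - 1) = (\<rho> - s0) / (\<alpha> * m s0 * t)"
    proof -
      have "1 / (1 - \<alpha>) * (\<alpha> - 1) = - 1" using \<alpha> by (simp add: field_simps)
      then have "\<eta> powr (\<alpha> - 1) = q powr (- 1)" unfolding \<eta>_def powr_powr by simp
      also have "\<dots> = 1 / q" using q by (simp add: powr_minus_divide)
      finally show ?thesis by (simp add: q_def)
    qed
    then have "char_map \<alpha> v t (s0, \<eta>) = s0 + (\<alpha> * m s0 * t) * ((\<rho> - s0) / (\<alpha> * m s0 * t))"
      by (simp add: char_map_def)
    then have "char_map \<alpha> v t (s0, \<eta>) = \<rho>"
      using pos less_imp_neq[OF pos] by simp
    ultimately show ?thesis by (metis image_eqI)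
  qed
qed

section \<open>Bounds for the quotient of solution and limit profile\<close>

text \<open>The largest rescaled displacement of a foot, attained at
  \<open>\<rho> = R\<close>.\<close>

definition spread :: "real \<Rightarrow> real \<Rightarrow> real" where
  "spread \<alpha> t = R * t powr (- 1 / \<alpha>) / (\<alpha> * m R)"

text \<open>The constant of \<open>add_powr_le\<close> for \<open>e = spread \<alpha> t\<close> and
  exponent \<open>\<alpha> / (1 - \<alpha>)\<close>.\<close>

definition upper_ratio :: "real \<Rightarrow> real \<Rightarrow> real" where
  "upper_ratio \<alpha> t = max ((1 + sqrt (spread \<alpha> t)) powr (\<alpha> / (1 - \<alpha>)))
     (1 + (spread \<alpha> t + sqrt (spread \<alpha> t)) powr (\<alpha> / (1 - \<alpha>)) / \<alpha>)"

text \<open>One entry for each side of the threshold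
  \<open>\<eta> = t powr (- 1 / (2 * \<alpha>))\<close>. The second is a power of a lower bound for
  the fraction of mass to the left of the foot, cut off at 0 because that bound may be negative for
  small \<open>t\<close>.\<close>

definition lower_ratio :: "real \<Rightarrow> real \<Rightarrow> real" where
  "lower_ratio \<alpha> t = min (\<alpha> / (\<alpha> + t powr (- 1 / 2)))
     (max 0 (1 - t powr (- 1 / (2 * \<alpha>)) * R / m R) powr (\<alpha> / (1 - \<alpha>)))"

lemma upper_ratio_tendsto:
  assumes "0 < \<alpha>" "\<alpha> < 1"
  shows "(upper_ratio \<alpha> \<longlongrightarrow> 1) at_top"
proof -
  have "((\<lambda>t. t powr (- 1 / \<alpha>)) \<longlongrightarrow> 0) at_top"
    using assms by (intro tendsto_neg_powr filterlim_ident) auto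
  from tendsto_divide[OF tendsto_mult_left[OF this, of R] tendsto_const[of "\<alpha> * m R"]]
  have s: "(spread \<alpha> \<longlongrightarrow> 0) at_top"
    using assms total_mass_pos by (simp add: spread_def[abs_def])
  have s0: "0 \<le> spread \<alpha> t" for t
    using assms total_mass_pos R_nonneg by (simp add: spread_def)
  have sq: "((\<lambda>t. sqrt (spread \<alpha> t)) \<longlongrightarrow> 0) at_top"
    using tendsto_real_sqrt[OF s] by simp
  have g: "0 < \<alpha> / (1 - \<alpha>)" using assms by simp
  have "((\<lambda>t. (1 + sqrt (spread \<alpha> t)) powr (\<alpha> / (1 - \<alpha>))) \<longlongrightarrow> (1 + 0) powr (\<alpha> / (1 - \<alpha>))) at_top"
    by (intro tendsto_intros sq) auto
  \<comment> \<open>Here the base tends to 0, so the limit rests on \<open>s0\<close> and on the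
    positive exponent from \<open>g\<close>.\<close>
  moreover have "((\<lambda>t. (spread \<alpha> t + sqrt (spread \<alpha> t)) powr (\<alpha> / (1 - \<alpha>))) \<longlongrightarrow> (0 + 0) powr (\<alpha> / (1 - \<alpha>))) at_top"
    using g s0 by (intro tendsto_powr2 tendsto_add s sq tendsto_const always_eventually) auto
  then have "((\<lambda>t. 1 + (spread \<alpha> t + sqrt (spread \<alpha> t)) powr (\<alpha> / (1 - \<alpha>)) / \<alpha>) \<longlongrightarrow> 1 + (0 + 0) powr (\<alpha> / (1 - \<alpha>)) / \<alpha>) at_top"
    using assms by (intro tendsto_add tendsto_divide tendsto_const) auto
  ultimately have "(upper_ratio \<alpha> \<longlongrightarrow> max ((1 + 0) powr (\<alpha> / (1 - \<alpha>))) (1 + (0 + 0) powr (\<alpha> / (1 - \<alpha>)) / \<alpha>)) at_top"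
    unfolding upper_ratio_def[abs_def] by (rule tendsto_max)
  then show ?thesis by simp
qed

lemma lower_ratio_tendsto:
  assumes "0 < \<alpha>" "\<alpha> < 1"
  shows "(lower_ratio \<alpha> \<longlongrightarrow> 1) at_top"
proof -
  have p: "((\<lambda>t::real. t powr (- 1 / 2)) \<longlongrightarrow> 0) at_top" "((\<lambda>t. t powr (- 1 / (2 * \<alpha>))) \<longlongrightarrow> 0) at_top"
    using assms by (intro tendsto_neg_powr filterlim_ident; simp)+
  have "((\<lambda>t. \<alpha> / (\<alpha> + t powr (- 1 / 2))) \<longlongrightarrow> \<alpha> / (\<alpha> + 0)) at_top"
    using assms by (intro tendsto_divide tendsto_add tendsto_const p) auto
  moreover have "((\<lambda>t. max 0 (1 - t powr (- 1 / (2 * \<alpha>)) * R / m R) powr (\<alpha> / (1 - \<alpha>)))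
      \<longlongrightarrow> max 0 (1 - 0 * R / m R) powr (\<alpha> / (1 - \<alpha>))) at_top"
    using assms total_mass_pos
    by (intro tendsto_powr tendsto_max tendsto_diff tendsto_divide tendsto_mult tendsto_const p) auto
  ultimately have "(lower_ratio \<alpha> \<longlongrightarrow> min (\<alpha> / (\<alpha> + 0)) (max 0 (1 - 0 * R / m R) powr (\<alpha> / (1 - \<alpha>)))) at_top"
    unfolding lower_ratio_def[abs_def] by (rule tendsto_min)
  then show ?thesis using assms by simp
qed

text \<open>The upper bound replaces the foot by \<open>R\<close> and the mass fraction by 1. The
  lower bound drops the displacement of the foot and needs the mass fraction close to 1, or else
  \<open>B\<close> small.\<close>

lemma characteristic_ratio_bounds:
  fixes \<alpha> t Y \<rho> \<eta> :: real
  assumes \<alpha>: "0 < \<alpha>" "\<alpha> < 1" and t: "0 < t"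
    and D: "(\<rho>, \<eta>) \<in> char_domain v"
    and eq: "char_map \<alpha> v t (\<rho>, \<eta>) = t powr (1 / \<alpha>) * Y"
  defines "A \<equiv> (Y / (\<alpha> * m R)) powr (\<alpha> / (1 - \<alpha>))"
    and "B \<equiv> \<eta> powr (- \<alpha>) / t"
  shows "lower_ratio \<alpha> t * (\<alpha> + B) \<le> \<alpha> + A" and "\<alpha> + A \<le> upper_ratio \<alpha> t * (\<alpha> + B)"
proof -
  define \<gamma> where "\<gamma> = \<alpha> / (1 - \<alpha>)"
  have \<gamma>: "0 < \<gamma>" using \<alpha> by (simp add: \<gamma>_def)
  note D = char_domainD[OF D]
  have B: "0 < B" using t D(1) by (simp add: B_def)
  \<comment> \<open>In terms of \<open>x\<close> the equation of the characteristic is affine: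
    \<open>Y / (\<alpha> * m R) = e + \<mu> * x\<close>, obtained by multiplying it by
    \<open>t powr (- 1 / \<alpha>)\<close>.\<close>
  define x where "x = B powr (1 / \<gamma>)"
  have x: "0 < x" using B by (simp add: x_def)
  have xB: "x powr \<gamma> = B" using B \<gamma> by (simp add: x_def powr_powr)
  define \<mu> where "\<mu> = m \<rho> / m R"
  have \<mu>: "0 \<le> \<mu>" "\<mu> \<le> 1"
    using mass_nonneg mass_le_total total_mass_pos D(2) by (auto simp: \<mu>_def)
  define e where "e = \<rho> * t powr (- 1 / \<alpha>) / (\<alpha> * m R)"
  have e: "0 \<le> e" "e \<le> spread \<alpha> t"
    unfolding e_def spread_def using D \<alpha> total_mass_pos
    by (auto intro!: divide_right_mono mult_right_mono)
  have "Y / (\<alpha> * m R) = e + \<mu> * x"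
  proof -
    have x_eq: "x = \<eta> powr (\<alpha> - 1) * t powr (1 - 1 / \<alpha>)"
    proof -
      have "x = (\<eta> powr (- \<alpha>) * t powr (- 1)) powr (1 / \<gamma>)"
        using t by (simp add: x_def B_def powr_minus_divide)
      also have "\<dots> = \<eta> powr (- \<alpha> * (1 / \<gamma>)) * t powr (- 1 * (1 / \<gamma>))"
        by (simp only: powr_mult powr_powr)
      also have "- \<alpha> * (1 / \<gamma>) = \<alpha> - 1"
        using \<alpha> by (simp add: \<gamma>_def field_simps)
      also have "- 1 * (1 / \<gamma>) = 1 - 1 / \<alpha>"
        using \<alpha> by (simp add: \<gamma>_def field_simps)
      finally show ?thesis .
    qed
    have "Y = t powr (- 1 / \<alpha>) * (t powr (1 / \<alpha>) * Y)"
      using t by (simp add: mult.assoc[symmetric] powr_add[symmetric])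
    also have "\<dots> = t powr (- 1 / \<alpha>) * (\<rho> + \<alpha> * m \<rho> * \<eta> powr (\<alpha> - 1) * t)"
      by (simp add: eq[symmetric] char_map_def)
    also have "\<dots> = \<rho> * t powr (- 1 / \<alpha>) + \<alpha> * m \<rho> * (\<eta> powr (\<alpha> - 1) * (t powr (- 1 / \<alpha>) * t powr 1))"
      using t by (simp add: algebra_simps)
    also have "t powr (- 1 / \<alpha>) * t powr 1 = t powr (1 - 1 / \<alpha>)"
      unfolding powr_add[symmetric] by (simp add: add.commute)
    also have "\<rho> * t powr (- 1 / \<alpha>) + \<alpha> * m \<rho> * (\<eta> powr (\<alpha> - 1) * t powr (1 - 1 / \<alpha>))
        = \<rho> * t powr (- 1 / \<alpha>) + \<alpha> * m \<rho> * x"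
      by (simp add: x_eq)
    finally show ?thesis
      using \<alpha> total_mass_pos by (simp add: e_def \<mu>_def add_divide_distrib)
  qed
  then have A: "A = (e + \<mu> * x) powr \<gamma>" by (simp add: A_def \<gamma>_def)
  have "A \<le> (spread \<alpha> t + x) powr \<gamma>"
    unfolding A using e \<mu> x \<gamma> by (intro powr_mono2 add_mono) (auto simp: mult_left_le_one_le)
  then have "\<alpha> + A \<le> \<alpha> + (spread \<alpha> t + x) powr \<gamma>" by simp
  also have "\<dots> \<le> upper_ratio \<alpha> t * (\<alpha> + x powr \<gamma>)"
    unfolding upper_ratio_def \<gamma>_def[symmetric] using \<alpha> \<gamma> e x by (intro add_powr_le) auto
  finally show "\<alpha> + A \<le> upper_ratio \<alpha> t * (\<alpha> + B)" by (simp add: xB)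
  \<comment> \<open>The split at \<open>\<eta> = \<delta>\<close> separates the rarefied values, whose characteristics have almost all the
    mass to their left, from those that contribute to \<open>B\<close> only \<open>O(t\<^bsup>-1/2\<^esup>)\<close>.\<close>
  define \<delta> where "\<delta> = t powr (- 1 / (2 * \<alpha>))"
  have \<delta>: "0 < \<delta>" using t by (simp add: \<delta>_def)
  show "lower_ratio \<alpha> t * (\<alpha> + B) \<le> \<alpha> + A"
  proof (cases "\<delta> \<le> \<eta>")
    case True
    have "B \<le> \<delta> powr (- \<alpha>) / t"
      unfolding B_def using True \<delta> \<alpha> t by (intro divide_right_mono powr_mono2') auto
    also have "\<delta> powr (- \<alpha>) = t powr (1 / 2)"
      using \<alpha> by (simp add: \<delta>_def powr_powr)
    also have "t powr (1 / 2) / t = t powr (1 / 2) / t powr 1" using t by simp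
    also have "\<dots> = t powr (- 1 / 2)" unfolding powr_diff[symmetric] by simp
    finally have Bt: "B \<le> t powr (- 1 / 2)" .
    \<comment> \<open>Since \<open>B\<close> is small, the term \<alpha> on the right suffices and
      \<open>A\<close> enters only through \<open>0 \<le> A\<close>.\<close>
    have "lower_ratio \<alpha> t * (\<alpha> + B) \<le> \<alpha> / (\<alpha> + t powr (- 1 / 2)) * (\<alpha> + t powr (- 1 / 2))"
      unfolding lower_ratio_def using \<alpha> B Bt by (intro mult_mono) auto
    also have "\<dots> = \<alpha>"
      using \<alpha> add_pos_nonneg[of \<alpha> "t powr (- 1 / 2)"] by simp
    also have "\<dots> \<le> \<alpha> + A" by (simp add: A_def)
    finally show ?thesis .
  next
    case False
    define k where "k = max 0 (1 - \<delta> * R / m R)"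
    have k: "0 \<le> k" "k \<le> 1"
      using \<delta> R_nonneg total_mass_pos by (auto simp: k_def)
    \<comment> \<open>To the right of the foot the profile is at most \<eta>, which is below
      \<delta>, and it lives on an interval of length \<open>R - \<rho>\<close>.\<close>
    have "m R - m \<rho> \<le> \<delta> * (R - \<rho>)"
      using D False by (intro mass_diff_bounds(2)[where c = 0]) (force intro: nonneg order.trans)+
    also have "\<dots> \<le> \<delta> * R" using D(2) \<delta> by (simp add: right_diff_distrib)
    finally have "(m R - \<delta> * R) / m R \<le> \<mu>"
      unfolding \<mu>_def using total_mass_pos by (intro divide_right_mono) auto
    then have "k \<le> \<mu>"
      using \<mu> total_mass_pos by (simp add: k_def diff_divide_distrib)
    then have "k * x \<le> e + \<mu> * x" using e x by (simp add: add_increasing mult_right_mono)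
    then have "(k * x) powr \<gamma> \<le> A" unfolding A using k x \<gamma> by (intro powr_mono2) auto
    moreover have "(k * x) powr \<gamma> = k powr \<gamma> * B"
      using k x xB by (simp add: powr_mult)
    \<comment> \<open>As \<open>k\<close> is at most 1, its power may also multiply the summand
      \<alpha>.\<close>
    moreover have "k powr \<gamma> * \<alpha> \<le> 1 * \<alpha>"
      using k \<gamma> \<alpha> by (intro mult_right_mono powr_le1) auto
    ultimately have "k powr \<gamma> * (\<alpha> + B) \<le> \<alpha> + A" by (simp add: distrib_left)
    moreover have "lower_ratio \<alpha> t * (\<alpha> + B) \<le> k powr \<gamma> * (\<alpha> + B)"
      unfolding lower_ratio_def k_def \<delta>_def \<gamma>_def using \<alpha> B by (intro mult_right_mono) auto
    ultimately show ?thesis by linarith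
  qed
qed

section \<open>A bound on the relative error that is uniform in space\<close>

lemma ratio_bounds_signs:
  assumes "0 < \<alpha>"
  shows "0 \<le> lower_ratio \<alpha> t" "0 \<le> upper_ratio \<alpha> t"
  using assms by (auto simp: lower_ratio_def upper_ratio_def le_max_iff_disj)

definition deviation :: "real \<Rightarrow> real \<Rightarrow> real" where
  "deviation \<alpha> t = \<bar>upper_ratio \<alpha> t powr (1 / \<alpha>) - 1\<bar> + \<bar>lower_ratio \<alpha> t powr (1 / \<alpha>) - 1\<bar>"

lemma deviation_tendsto:
  assumes "0 < \<alpha>" "\<alpha> < 1"
  shows "(deviation \<alpha> \<longlongrightarrow> 0) at_top"
proof -
  have "(deviation \<alpha> \<longlongrightarrow> \<bar>1 powr (1 / \<alpha>) - 1\<bar> + \<bar>1 powr (1 / \<alpha>) - 1\<bar>) at_top"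
    unfolding deviation_def[abs_def]
    by (intro tendsto_add tendsto_rabs tendsto_diff tendsto_powr tendsto_const
        upper_ratio_tendsto lower_ratio_tendsto assms) auto
  then show ?thesis by simp
qed

text \<open>The relative error equals
  \<open>((\<alpha> + A) / (\<alpha> + B)) powr (1 / \<alpha>) - 1\<close>, and the bounds on this
  ratio depend on \<open>t\<close> but not on \<open>y\<close>.\<close>

lemma relative_error_le:
  fixes y :: "'a::euclidean_space"
  assumes \<alpha>: "0 < \<alpha>" "\<alpha> < 1" and t: "0 < t"
  shows "\<bar>(rescaled \<alpha> (char_solution \<alpha> v) t y - F_profile DIM('a) \<alpha> (m R) (norm y))
      / F_profile DIM('a) \<alpha> (m R) (norm y)\<bar> \<le> deviation \<alpha> t"
proof -
  define z where "z = t powr (1 / (real DIM('a) * \<alpha>)) *\<^sub>R y"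
  define Y where "Y = vol_var y"
  have Y: "0 \<le> Y" by (simp add: Y_def vol_var_def)
  \<comment> \<open>The spatial dilation multiplies volumes by \<open>t powr (1 / \<alpha>)\<close>,
    whatever the dimension.\<close>
  have "(t powr (1 / (real DIM('a) * \<alpha>))) ^ DIM('a) = t powr (1 / \<alpha>)"
    using t \<alpha> by (simp add: powr_realpow[symmetric] powr_powr)
  then have z: "vol_var z = t powr (1 / \<alpha>) * Y"
    by (simp add: z_def Y_def vol_var_def power_mult_distrib)
  obtain \<rho> \<eta> where pre: "inv_into (char_domain v) (char_map \<alpha> v t) (vol_var z) = (\<rho>, \<eta>)"
    by fastforce
  have surj: "vol_var z \<in> char_map \<alpha> v t ` char_domain v"
    using Y z by (intro char_map_surj \<alpha> t) simp
  have D: "(\<rho>, \<eta>) \<in> char_domain v"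
    using inv_into_into[OF surj] pre by simp
  have eq: "char_map \<alpha> v t (\<rho>, \<eta>) = t powr (1 / \<alpha>) * Y"
    using f_inv_into_f[OF surj] pre z by simp
  define A where "A = (Y / (\<alpha> * m R)) powr (\<alpha> / (1 - \<alpha>))"
  define B where "B = \<eta> powr (- \<alpha>) / t"
  have A: "0 < \<alpha> + A" using \<alpha> by (simp add: A_def add_pos_nonneg)
  have B: "0 < \<alpha> + B" using \<alpha> t by (simp add: B_def add_pos_nonneg)
  have F: "F_profile DIM('a) \<alpha> (m R) (norm y) = (\<alpha> + A) powr (- 1 / \<alpha>)"
    by (simp add: F_profile_def A_def Y_def vol_var_def)
  have "rescaled \<alpha> (char_solution \<alpha> v) t y = t powr (1 / \<alpha>) * (\<eta> powr (- \<alpha>) + \<alpha> * t) powr (- 1 / \<alpha>)"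
    unfolding rescaled_def char_solution_def z_def[symmetric] pre by simp
  also have "\<eta> powr (- \<alpha>) + \<alpha> * t = t * (\<alpha> + B)"
    using t by (simp add: B_def algebra_simps)
  also have "t powr (1 / \<alpha>) * (t * (\<alpha> + B)) powr (- 1 / \<alpha>) = (\<alpha> + B) powr (- 1 / \<alpha>)"
    using t B by (simp add: powr_mult mult.assoc[symmetric] powr_add[symmetric])
  finally have w: "rescaled \<alpha> (char_solution \<alpha> v) t y = (\<alpha> + B) powr (- 1 / \<alpha>)" .
  have "(\<alpha> + B) powr (- 1 / \<alpha>) / (\<alpha> + A) powr (- 1 / \<alpha>) = ((\<alpha> + A) / (\<alpha> + B)) powr (1 / \<alpha>)"
    using A B by (simp add: powr_divide powr_minus_divide field_simps)
  then have "(rescaled \<alpha> (char_solution \<alpha> v) t y - F_profile DIM('a) \<alpha> (m R) (norm y))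
      / F_profile DIM('a) \<alpha> (m R) (norm y) = ((\<alpha> + A) / (\<alpha> + B)) powr (1 / \<alpha>) - 1"
    using A by (simp add: w F diff_divide_distrib)
  moreover note characteristic_ratio_bounds[OF \<alpha> t D eq, folded A_def B_def]
  then have "lower_ratio \<alpha> t \<le> (\<alpha> + A) / (\<alpha> + B)" "(\<alpha> + A) / (\<alpha> + B) \<le> upper_ratio \<alpha> t"
    using B by (simp_all add: pos_le_divide_eq pos_divide_le_eq)
  ultimately show ?thesis
    unfolding deviation_def using \<alpha> ratio_bounds_signs by (simp add: powr_deviation)
qed

end

section \<open>From the datum to its profile\<close>

text \<open>Every interval contains a point where the almost-everywhere property holds for
  \<open>v\<close>, and monotonicity carries it to the point wanted. \<open>R\<close> is the volume
  variable on the sphere of a ball containing the support.\<close>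

lemma volume_profile_of_datum:
  fixes u0 :: "'a::euclidean_space \<Rightarrow> real"
  assumes supp: "compactly_supported u0"
    and nonneg: "AE x in lebesgue. 0 \<le> u0 x"
    and nonzero: "\<not> (AE x in lebesgue. u0 x = 0)"
    and prof: "nonincreasing_profile u0 v"
  obtains R where "volume_profile v R"
proof -
  have anti: "antimono_on {0..} v" and rep: "AE x in lebesgue. u0 x = v (vol_var x)"
    using prof by (auto simp: nonincreasing_profile_def)
  have le: "v b \<le> v a" if "0 \<le> a" "a \<le> b" for a b
    using anti that by (auto simp: monotone_on_def)
  have v_nonneg: "0 \<le> v s" if "0 \<le> s" for s
  proof -
    have "AE x::'a in lebesgue. 0 \<le> v (vol_var x)"
      using nonneg rep by eventually_elim simp
    from AE_vol_var_interval[OF that less_add_one this] obtain r where "s < r" "0 \<le> v r" by auto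
    then show ?thesis using le[of s r] that by simp
  qed
  obtain K where K: "compact K" "AE x in lebesgue. x \<notin> K \<longrightarrow> u0 x = 0"
    using supp by (auto simp: compactly_supported_def)
  obtain r where r: "0 < r" "\<And>x. x \<in> K \<Longrightarrow> norm x \<le> r"
    using compact_imp_bounded[OF K(1)] by (auto simp: bounded_pos)
  obtain y :: 'a where y: "norm y = r" using vector_choose_size[of r] r by auto
  define R where "R = vol_var y"
  have "0 \<le> R" by (simp add: R_def vol_var_nonneg)
  have v_support: "v s = 0" if "R < s" for s
  proof -
    have "AE x::'a in lebesgue. R < vol_var x \<longrightarrow> v (vol_var x) = 0"
      using K(2) rep
    proof eventually_elim
      case (elim x)
      then show ?case using r(2)[of x] vol_var_le_iff[of x y] by (auto simp: R_def y not_less[symmetric])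
    qed
    from AE_vol_var_interval[OF \<open>0 \<le> R\<close> that this] obtain r where r: "R < r" "r < s" "v r = 0"
      by auto
    then show ?thesis using le[of r s] v_nonneg[of s] \<open>0 \<le> R\<close> by simp
  qed
  have "\<exists>s>0. 0 < v s"
  proof (rule ccontr)
    assume "\<not> ?thesis"
    then have zero: "v s = 0" if "0 < s" for s
      using v_nonneg[of s] that by (fastforce simp: less_eq_real_def)
    \<comment> \<open>A profile vanishing on all positive arguments can be nonzero only at the
      origin, a null set.\<close>
    have "AE x in lborel. x \<noteq> (0::'a)" by (rule AE_lborel_singleton)
    then have "AE x in lebesgue. x \<noteq> (0::'a)" by (rule AE_completion)
    with rep have "AE x in lebesgue. u0 x = 0"
      by eventually_elim (simp add: zero vol_var_def)
    with nonzero show False by simp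
  qed
  with anti v_nonneg \<open>0 \<le> R\<close> v_support have "volume_profile v R"
    by (simp add: volume_profile_def)
  then show thesis ..
qed

text \<open>Identifies the norm of the datum with the total mass through
  \<open>distr_vol_var\<close>. The Borel extension \<open>V\<close> stands in for \<open>v\<close>,
  whose values at negative arguments are arbitrary.\<close>

lemma (in volume_profile) integral_radial:
  fixes u0 :: "'a::euclidean_space \<Rightarrow> real"
  assumes [measurable]: "u0 \<in> borel_measurable lebesgue"
    and rep: "AE x in lebesgue. u0 x = v (vol_var x)"
  shows "(LINT x|lebesgue. \<bar>u0 x\<bar>) = m R"
proof -
  define V where "V = (\<lambda>s. v (max 0 s))"
  have [measurable]: "V \<in> borel_measurable borel"
    unfolding V_def by (rule measurable_extension)
  have V_eq: "V (vol_var x) = v (vol_var x)" for x :: 'a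
    using vol_var_nonneg[of x] by (simp add: V_def)
  have [measurable]: "(\<lambda>x::'a. V (vol_var x)) \<in> borel_measurable lebesgue"
    by (rule measurable_completion) measurable
  have "(LINT x|lebesgue. \<bar>u0 x\<bar>) = (LINT x|lebesgue. V (vol_var (x::'a)))"
  proof (rule integral_cong_AE)
    show "AE x in lebesgue. \<bar>u0 x\<bar> = V (vol_var x)"
      using rep by eventually_elim (simp add: V_eq nonneg vol_var_nonneg)
  qed measurable
  also have "\<dots> = (LINT x|lborel. V (vol_var (x::'a)))"
    by (rule integral_completion) measurable
  also have "\<dots> = (LINT s|distr lborel borel (vol_var :: 'a \<Rightarrow> real). V s)"
    by (rule integral_distr[symmetric]) measurable
  also have "\<dots> = (LINT s|lborel. indicator {0..} s *\<^sub>R V s)"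
    unfolding distr_vol_var
    using integral_density[of V lborel "indicator {0..}"] by (simp add: ennreal_indicator)
  \<comment> \<open>The profile vanishes beyond \<open>R\<close>, so the half-line may be cut to
    \<open>{0..R}\<close>.\<close>
  also have "\<dots> = m R"
    unfolding cumulated_mass_def set_lebesgue_integral_def
    by (rule Bochner_Integration.integral_cong) (auto simp: V_def indicator_def support)
  finally show ?thesis .
qed

section \<open>Convergence of the supremum of the relative error\<close>

theorem theorem4p6:
  fixes \<alpha> M :: real
    and u0 :: "'a::euclidean_space \<Rightarrow> real"
    and v0 :: "real \<Rightarrow> real"
    and u w :: "real \<Rightarrow> 'a \<Rightarrow> real"
    and F :: "real \<Rightarrow> real"
  assumes "0 < \<alpha>" and "\<alpha> < 1"
    and "ess_bounded u0"
    and "compactly_supported u0"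
    and "AE x in lebesgue. 0 \<le> u0 x"
    and "\<not> (AE x in lebesgue. u0 x = 0)"
    and "nonincreasing_profile u0 v0"
  defines "M \<equiv> (LINT x|lebesgue. \<bar>u0 x\<bar>)"
    and "u \<equiv> char_solution \<alpha> v0"
    and "w \<equiv> rescaled \<alpha> u"
    and "F \<equiv> F_profile DIM('a) \<alpha> M"
  shows "((\<lambda>t. SUP y. ereal \<bar>(w t y - F (norm y)) / F (norm y)\<bar>) \<longlongrightarrow> 0) at_top"
proof -
  obtain R where "volume_profile v0 R"
    using volume_profile_of_datum[OF assms(4-7)] .
  then interpret volume_profile v0 R .
  have M: "M = cumulated_mass v0 R"
    unfolding M_def using assms(3,7)
    by (intro integral_radial) (auto simp: ess_bounded_def nonincreasing_profile_def)
  show ?thesis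
  \<comment> \<open>The supremum, taken in the extended reals, lies between 0 and
    \<open>deviation \<alpha> t\<close> for all \<open>t > 0\<close>.\<close>
  proof (rule tendsto_sandwich)
    show "\<forall>\<^sub>F t in at_top. 0 \<le> (SUP y. ereal \<bar>(w t y - F (norm y)) / F (norm y)\<bar>)"
      by (intro always_eventually allI SUP_upper2[of 0]) auto
    show "\<forall>\<^sub>F t in at_top. (SUP y. ereal \<bar>(w t y - F (norm y)) / F (norm y)\<bar>) \<le> ereal (deviation \<alpha> t)"
      using eventually_gt_at_top[of 0]
    proof eventually_elim
      case (elim t)
      then show ?case
        unfolding w_def u_def F_def M
        by (intro SUP_least) (unfold ereal_less_eq, rule relative_error_le[OF assms(1,2)])
    qed
    show "((\<lambda>t. ereal (deviation \<alpha> t)) \<longlongrightarrow> 0) at_top"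
      using deviation_tendsto[OF assms(1,2)] by (simp add: zero_ereal_def)
  qed simp
qed

end
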